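(* Let $T\subset\mathbb{R}^3$ be a tetrahedron and let $e,e'$ be opposite edges of $T$ that both have obtuse dihedral angles. Then there exist non-trivial intervals $I\subset\operatorname{relint}(e)$ and $I'\subset\operatorname{relint}(e')$ such that: (i) for $p\in e$, the affine plane $\Pi_p=\operatorname{aff}(e'\cup\{p\})$ induces a height function tetrahedral subdivision of $T$ if and only if $p\in I$; and (ii) for $p\in e'$, the affine plane $\Pi_p=\operatorname{aff}(e\cup\{p\})$ induces a height function tetrahedral subdivision of $T$ if and only if $p\in I'$.
   Context: A tetrahedron is the convex hull of four affinely independent points of $\mathbb{R}^3$. The dihedral angle of a tetrahedron at an edge is the interior angle, in $(0,\pi)$, between the two faces containing that edge; it is obtuse if it is greater than $\pi/2$. A polyhedron $P\subset\mathbb{R}^3$ is a height function if there is a (two-dimensional) face $F$ of $P$ such that the orthogonal projection $\pi_F:\mathbb{R}^3\to\operatorname{aff}(F)$ satisfies $\pi_F(P)\subseteq F$. An affine plane $\Pi$ induces a tetrahedral subdivision of $T$ if $T=T_0\cup T_1$ with $T_0\cap T_1=T\cap\Pi$, where $T_0,T_1$ are distinct (3-dimensional, non-degenerate) tetrahedra, one contained in each of the two closed half-spaces determined by $\Pi$. It is a height function tetrahedral subdivision if moreover $T_0$ and $T_1$ are both height functions. A non-trivial interval in an edge is a connected subset (sub-segment) with more than one point. *)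

theory Defs
  imports "HOL-Analysis.Analysis"
begin

abbreviation tetrahedron :: "(real^3) set \<Rightarrow> bool" where
  "tetrahedron T \<equiv> 3 simplex T"

text \<open>The unit vector parallel to the plane of the face \<open>F\<close>, perpendicular to its edge \<open>e\<close>,
  and pointing from \<open>e\<close> into \<open>F\<close>. It is unique when \<open>F\<close> is a convex polygon with edge \<open>e\<close>.\<close>

definition conormal :: "(real^3) set \<Rightarrow> (real^3) set \<Rightarrow> real^3" where
  "conormal e F = (THE u. norm u = 1 \<and>
     (\<forall>x\<in>e. \<forall>y\<in>e. u \<bullet> (x - y) = 0) \<and>
     (\<exists>x\<in>rel_interior e. \<exists>t>0. x + t *\<^sub>R u \<in> F))"

text \<open>The interior angle between the two facets of \<open>T\<close> containing the edge \<open>e\<close>, that is, the angle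
  between their two conormals at \<open>e\<close>.\<close>

definition dihedral_angle :: "(real^3) set \<Rightarrow> (real^3) set \<Rightarrow> real" where
  "dihedral_angle T e = (THE \<theta>. \<exists>F G. F facet_of T \<and> G facet_of T \<and> F \<noteq> G \<and>
     e \<subseteq> F \<and> e \<subseteq> G \<and> \<theta> = arccos (conormal e F \<bullet> conormal e G))"

text \<open>The closest-point map of a nonempty affine subspace is the orthogonal projection onto it.\<close>

definition height_function :: "(real^3) set \<Rightarrow> bool" where
  "height_function P \<longleftrightarrow> polyhedron P \<and>
     (\<exists>F. F face_of P \<and> aff_dim F = 2 \<and> closest_point (affine hull F) ` P \<subseteq> F)"

definition tetrahedral_subdivision ::
  "(real^3) set \<Rightarrow> (real^3) set \<Rightarrow> (real^3) set \<Rightarrow> (real^3) set \<Rightarrow> bool" where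
  "tetrahedral_subdivision H T T0 T1 \<longleftrightarrow>
     tetrahedron T0 \<and> tetrahedron T1 \<and> T0 \<noteq> T1 \<and>
     T = T0 \<union> T1 \<and> T0 \<inter> T1 = T \<inter> H \<and>
     (\<exists>n c. n \<noteq> 0 \<and> H = {x. n \<bullet> x = c} \<and>
        T0 \<subseteq> {x. n \<bullet> x \<le> c} \<and> T1 \<subseteq> {x. n \<bullet> x \<ge> c})"

definition induces_height_function_subdivision :: "(real^3) set \<Rightarrow> (real^3) set \<Rightarrow> bool" where
  "induces_height_function_subdivision H T \<longleftrightarrow>
     (\<exists>T0 T1. tetrahedral_subdivision H T T0 T1 \<and> height_function T0 \<and> height_function T1)"

text \<open>To be used with \<open>S\<close> contained in a line, where connected subsets are intervals.\<close>

definition nontrivial_interval_in :: "(real^3) set \<Rightarrow> (real^3) set \<Rightarrow> bool" where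
  "nontrivial_interval_in S I \<longleftrightarrow> I \<subseteq> S \<and> connected I \<and> (\<exists>x\<in>I. \<exists>y\<in>I. x \<noteq> y)"

end

theory Submission
  imports Defs
begin

text \<open>Let \<open>g v\<close> be the gradient of the barycentric coordinate of the vertex \<open>v\<close>, an inner normal of the
  facet opposite to \<open>v\<close>. The gradients sum to \<open>0\<close>. The angle at the edge \<open>ab\<close> of a tetrahedron \<open>abcd\<close> is
  obtuse iff \<open>g c \<bullet> g d > 0\<close>, and a simplex is a height function iff some \<open>g v\<close> has nonpositive inner
  product with all the other gradients. For \<open>p = (1 - t) a + t b\<close>, the pieces \<open>apcd\<close> and \<open>bpcd\<close> have, up to
  positive factors, the gradients \<open>m, g b, g c, g d\<close> and \<open>-m, g a, g c, g d\<close> with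
  \<open>m = t g a - (1 - t) g b\<close>. Thus the condition on \<open>t\<close> is a conjunction of linear inequalities and of
  disjunctions in which one alternative does not depend on \<open>t\<close>, so it defines an interval. To see that
  the interval is nontrivial, one treats the case where the other four angles are not obtuse, and the
  case where one of them is: then the facet between this obtuse edge and \<open>cd\<close> has an obtuse plane angle,
  so its other plane angles are acute, which is what the additional linear inequality needs.\<close>

subsection \<open>Barycentric coordinates and their gradients\<close>

text \<open>The affine function \<open>1 + g v \<bullet> (x - v)\<close> has value 1 at
  \<open>v\<close>. Prescribing Kronecker delta values at the vertices makes it the barycentric
  coordinate of \<open>v\<close>, and affine independence of \<open>S\<close> becomes a
  consequence.\<close>

locale simplex_gradients =
  fixes S :: "'a::euclidean_space set" and g :: "'a \<Rightarrow> 'a"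
  assumes card_vertices: "card S = DIM('a) + 1"
    and gradient_vertex: "\<And>v w. v \<in> S \<Longrightarrow> w \<in> S \<Longrightarrow> 1 + g v \<bullet> (w - v) = (if w = v then 1 else 0)"
begin

definition bary :: "'a \<Rightarrow> 'a \<Rightarrow> real" where
  "bary v x = 1 + g v \<bullet> (x - v)"

lemma finite_vertices: "finite S"
  using card_vertices card.infinite by fastforce

lemma bary_vertex: "v \<in> S \<Longrightarrow> w \<in> S \<Longrightarrow> bary v w = (if w = v then 1 else 0)"
  using gradient_vertex by (simp add: bary_def)

lemma bary_add: "bary v (x + y) = bary v x + g v \<bullet> y"
  by (simp add: bary_def algebra_simps)

text \<open>Affine functions commute with affine combinations, and among the values at the vertices
  only the one at \<open>v\<close> survives.\<close>

lemma bary_affine_sum: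
  assumes "v \<in> S" "sum u S = 1"
  shows "bary v (\<Sum>w\<in>S. u w *\<^sub>R w) = u v"
proof -
  define k where "k = 1 - g v \<bullet> v"
  have bary: "bary v x = k + g v \<bullet> x" for x
    by (simp add: bary_def k_def inner_diff_right)
  have "bary v (\<Sum>w\<in>S. u w *\<^sub>R w) = sum u S * k + (\<Sum>w\<in>S. u w * (g v \<bullet> w))"
    by (simp add: bary assms(2) inner_sum_right)
  also have "\<dots> = (\<Sum>w\<in>S. u w * bary v w)"
    by (simp add: bary distrib_left sum.distrib sum_distrib_right)
  also have "\<dots> = (\<Sum>w\<in>S. if w = v then u w else 0)"
    using assms(1) by (intro sum.cong) (auto simp: bary_vertex)
  also have "\<dots> = u v"
    using assms(1) finite_vertices by simp
  finally show ?thesis .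
qed

lemma affine_independent: "\<not> affine_dependent S"
proof
  assume "affine_dependent S"
  then obtain u where u: "sum u S = 0" "\<exists>v\<in>S. u v \<noteq> 0" "(\<Sum>v\<in>S. u v *\<^sub>R v) = 0"
    using finite_vertices affine_dependent_explicit_finite by blast
  then obtain v where v: "v \<in> S" "u v \<noteq> 0" by blast
  \<comment> \<open>Adding the dependence to the trivial representation of \<open>v\<close>
    represents \<open>v\<close> with a coefficient other than 1 at \<open>v\<close>, contradicting
    \<open>bary v v = 1\<close>.\<close>
  let ?u = "\<lambda>w. u w + (if w = v then 1 else 0)"
  have "(\<Sum>w\<in>S. ?u w *\<^sub>R w) = v"
    using u(3) v(1) finite_vertices by (simp add: algebra_simps sum.distrib if_distrib[of "\<lambda>x. x *\<^sub>R _"] cong: if_cong)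
  moreover have "sum ?u S = 1"
    using u(1) v(1) finite_vertices by (simp add: sum.distrib)
  ultimately have "bary v v = ?u v"
    using bary_affine_sum[OF v(1), of ?u] by simp
  then show False using v by (simp add: bary_vertex)
qed

lemma aff_dim_vertices: "aff_dim S = int DIM('a)"
  using aff_dim_affine_independent[OF affine_independent] card_vertices by simp

lemma affine_hull_vertices: "affine hull S = UNIV"
  using aff_dim_vertices affine_independent card_vertices by (simp add: aff_dim_eq_full)

lemma bary_sum: "(\<Sum>v\<in>S. bary v x) = 1" and bary_combination: "(\<Sum>v\<in>S. bary v x *\<^sub>R v) = x"
proof -
  have "x \<in> affine hull S" by (simp add: affine_hull_vertices)
  then obtain u where u: "sum u S = 1" "(\<Sum>v\<in>S. u v *\<^sub>R v) = x"
    unfolding affine_hull_finite[OF finite_vertices] by blast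
  then have "bary v x = u v" if "v \<in> S" for v
    using bary_affine_sum[OF that u(1)] by simp
  then show "(\<Sum>v\<in>S. bary v x) = 1" "(\<Sum>v\<in>S. bary v x *\<^sub>R v) = x"
    using u by simp_all
qed

text \<open>This is the linear part of \<open>bary_combination\<close>: subtract its instances at
  \<open>y\<close> and at 0.\<close>

lemma gradient_combination: "(\<Sum>v\<in>S. (g v \<bullet> y) *\<^sub>R v) = y"
proof -
  have "(\<Sum>v\<in>S. bary v (0 + y) *\<^sub>R v) = 0 + y" by (rule bary_combination)
  then show ?thesis
    using bary_combination[of 0] unfolding bary_add by (simp add: algebra_simps sum.distrib)
qed

lemma sum_gradients_inner: "(\<Sum>v\<in>S. g v \<bullet> y) = 0"
proof -
  have "(\<Sum>v\<in>S. bary v (0 + y)) = 1" by (rule bary_sum)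
  then show ?thesis
    using bary_sum[of 0] unfolding bary_add by (simp add: algebra_simps sum.distrib)
qed

lemma sum_gradients: "(\<Sum>v\<in>S. g v) = 0"
proof -
  have "(\<Sum>v\<in>S. g v) \<bullet> (\<Sum>v\<in>S. g v) = 0"
    by (simp only: inner_sum_left sum_gradients_inner)
  then show ?thesis by simp
qed

text \<open>Barycentric coordinates are unique, so the face spanned by \<open>C\<close> is cut out
  by sign conditions. Stated for all \<open>C\<close> in order to cover the simplex, its facets and
  its edges.\<close>

lemma mem_hull_subset_iff:
  assumes "C \<subseteq> S"
  shows "x \<in> convex hull C \<longleftrightarrow> (\<forall>v\<in>S. bary v x \<ge> 0) \<and> (\<forall>v\<in>S - C. bary v x = 0)"
proof
  assume "x \<in> convex hull C"
  then obtain u where u: "\<forall>v\<in>C. 0 \<le> u v" "sum u C = 1" "(\<Sum>v\<in>C. u v *\<^sub>R v) = x"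
    unfolding convex_hull_finite[OF finite_subset[OF assms finite_vertices]] by blast
  let ?u = "\<lambda>v. if v \<in> C then u v else 0"
  have "sum ?u S = 1" "(\<Sum>v\<in>S. ?u v *\<^sub>R v) = x"
    using u assms finite_vertices
    by (simp_all add: if_distrib[of "\<lambda>x. x *\<^sub>R _"] sum.If_cases Int_absorb1 cong: if_cong)
  then have "bary v x = ?u v" if "v \<in> S" for v
    using bary_affine_sum[OF that, of ?u] by simp
  then show "(\<forall>v\<in>S. bary v x \<ge> 0) \<and> (\<forall>v\<in>S - C. bary v x = 0)" using u by auto
next
  assume *: "(\<forall>v\<in>S. bary v x \<ge> 0) \<and> (\<forall>v\<in>S - C. bary v x = 0)"
  then have "(\<Sum>v\<in>C. bary v x) = (\<Sum>v\<in>S. bary v x)" "(\<Sum>v\<in>C. bary v x *\<^sub>R v) = (\<Sum>v\<in>S. bary v x *\<^sub>R v)"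
    using assms finite_vertices by (auto intro!: sum.mono_neutral_left)
  then show "x \<in> convex hull C"
    unfolding convex_hull_finite[OF finite_subset[OF assms finite_vertices]]
    using * assms by (auto simp: bary_sum bary_combination intro!: exI[of _ "\<lambda>v. bary v x"])
qed

lemma mem_hull_iff: "x \<in> convex hull S \<longleftrightarrow> (\<forall>v\<in>S. bary v x \<ge> 0)"
  using mem_hull_subset_iff[of S] by simp

lemma mem_affine_hull_facet_iff:
  assumes "v \<in> S"
  shows "x \<in> affine hull (S - {v}) \<longleftrightarrow> bary v x = 0"
proof
  have "affine {x. bary v x = 0}"
  proof -
    have "{x. bary v x = 0} = {x. g v \<bullet> x = g v \<bullet> v - 1}"
      by (auto simp: bary_def algebra_simps)
    then show ?thesis by (simp add: affine_hyperplane)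
  qed
  moreover have "S - {v} \<subseteq> {x. bary v x = 0}"
    using assms by (auto simp: bary_vertex)
  ultimately have "affine hull (S - {v}) \<subseteq> {x. bary v x = 0}"
    by (simp add: hull_minimal)
  then show "x \<in> affine hull (S - {v}) \<Longrightarrow> bary v x = 0" by blast
next
  assume *: "bary v x = 0"
  have "(\<Sum>w\<in>S-{v}. bary w x) = 1" "(\<Sum>w\<in>S-{v}. bary w x *\<^sub>R w) = x"
    using * assms finite_vertices bary_sum[of x] bary_combination[of x]
    by (simp_all add: sum.remove[of S v])
  then show "x \<in> affine hull (S - {v})"
    using finite_vertices by (auto simp: affine_hull_finite intro!: exI[of _ "\<lambda>v. bary v x"])
qed

lemma gradient_nonzero:
  assumes "v \<in> S"
  shows "g v \<noteq> 0"
proof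
  assume "g v = 0"
  moreover have "S \<noteq> {v}" using card_vertices by auto
  then obtain w where "w \<in> S" "w \<noteq> v" using assms by blast
  ultimately show False using gradient_vertex[OF assms] by fastforce
qed

text \<open>\<open>g v\<close> is normal to the facet plane, so the foot of the perpendicular is
  reached by moving along \<open>g v\<close> until \<open>bary v\<close> vanishes; Pythagoras shows
  that it is closest.\<close>

lemma closest_point_facet:
  assumes "v \<in> S"
  shows "closest_point (affine hull (S - {v})) x = x - (bary v x / (g v \<bullet> g v)) *\<^sub>R g v"
    (is "_ = ?y")
proof (rule closest_point_unique[symmetric])
  have "g v \<bullet> g v \<noteq> 0" using gradient_nonzero[OF assms] by simp
  then have y: "bary v ?y = 0" 
    by (simp add: bary_def inner_diff_right)
  then show "?y \<in> affine hull (S - {v})" by (simp add: mem_affine_hull_facet_iff assms)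
  show "\<forall>z\<in>affine hull (S - {v}). dist x ?y \<le> dist x z"
  proof
    fix z assume "z \<in> affine hull (S - {v})"
    then have "bary v z = 0" by (simp add: mem_affine_hull_facet_iff assms)
    then have "g v \<bullet> (?y - z) = 0" using y by (simp add: bary_def inner_diff_right)
    then have "orthogonal (x - ?y) (?y - z)" by (simp add: orthogonal_def)
    then have "norm ((x - ?y) + (?y - z)) ^ 2 = norm (x - ?y) ^ 2 + norm (?y - z) ^ 2"
      by (rule norm_add_Pythagorean)
    then have "norm (x - ?y) ^ 2 \<le> norm (x - z) ^ 2" by simp
    then show "dist x ?y \<le> dist x z"
      unfolding dist_norm by (rule power2_le_imp_le) simp
  qed
qed (auto simp: affine_imp_convex closed_affine_hull)

text \<open>Projecting lowers \<open>bary w\<close> by a nonnegative multiple of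
  \<open>g v \<bullet> g w\<close>. Necessity is tested at the vertex \<open>v\<close>, where all
  other coordinates are 0.\<close>

lemma closest_point_facet_image_subset_iff:
  assumes "v \<in> S"
  shows "closest_point (affine hull (S - {v})) ` (convex hull S) \<subseteq> convex hull (S - {v}) \<longleftrightarrow>
    (\<forall>w\<in>S - {v}. g v \<bullet> g w \<le> 0)"
proof -
  have pos: "g v \<bullet> g v > 0" using gradient_nonzero[OF assms] by simp
  have proj: "bary w (closest_point (affine hull (S - {v})) x)
      = bary w x - bary v x * (g v \<bullet> g w) / (g v \<bullet> g v)" for w x
  proof -
    have "bary w (x - k *\<^sub>R g v) = bary w x - k * (g v \<bullet> g w)" for k
      by (simp add: bary_def inner_diff_right inner_commute[of "g w" "g v"])
    then show ?thesis by (simp add: closest_point_facet[OF assms])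
  qed
  show ?thesis
  proof
    assume L: "closest_point (affine hull (S - {v})) ` (convex hull S) \<subseteq> convex hull (S - {v})"
    show "\<forall>w\<in>S - {v}. g v \<bullet> g w \<le> 0"
    proof
      fix w assume w: "w \<in> S - {v}"
      have "closest_point (affine hull (S - {v})) v \<in> convex hull (S - {v})"
        using L hull_inc[OF assms, of convex] by (rule subsetD[OF _ imageI])
      then have "bary w (closest_point (affine hull (S - {v})) v) \<ge> 0"
        using w mem_hull_subset_iff[of "S - {v}"] by blast
      then have "(g v \<bullet> g w) / (g v \<bullet> g v) \<le> 0"
        using w assms by (auto simp: proj bary_vertex)
      then show "g v \<bullet> g w \<le> 0"
        using pos by (metis divide_pos_pos not_le)
    qed
  next
    assume R: "\<forall>w\<in>S - {v}. g v \<bullet> g w \<le> 0"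
    show "closest_point (affine hull (S - {v})) ` (convex hull S) \<subseteq> convex hull (S - {v})"
    proof
      fix y assume "y \<in> closest_point (affine hull (S - {v})) ` (convex hull S)"
      then obtain x where x: "x \<in> convex hull S" "y = closest_point (affine hull (S - {v})) x"
        by blast
      have nonneg: "bary w x \<ge> 0" if "w \<in> S" for w using x that mem_hull_iff by blast
      have 0: "bary v y = 0" using pos by (simp add: x(2) proj)
      moreover have "bary w y \<ge> 0" if "w \<in> S" for w
      proof (cases "w = v")
        case False
        then have "bary v x * (g v \<bullet> g w) / (g v \<bullet> g v) \<le> 0"
          using R that pos nonneg[OF assms] by (simp add: divide_le_0_iff mult_nonneg_nonpos)
        then show ?thesis using nonneg[OF that] by (simp add: x(2) proj)
      qed (simp add: 0)
      ultimately show "y \<in> convex hull (S - {v})"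
        using mem_hull_subset_iff[of "S - {v}"] by auto
    qed
  qed
qed

end

section \<open>Existence of the gradients, and simplices that are height functions\<close>

lemma simplex_gradients_exist:
  fixes S :: "'a::euclidean_space set"
  assumes "\<not> affine_dependent S" "card S = DIM('a) + 1"
  shows "\<exists>g. simplex_gradients S g"
proof -
  have "\<exists>h. \<forall>w\<in>S. 1 + h \<bullet> (w - v) = (if w = v then 1 else 0)" if v: "v \<in> S" for v
  proof -
    have "independent ((\<lambda>x. x - v) ` (S - {v}))"
      using assms(1) affine_dependent_iff_dependent2[OF v] by simp
    \<comment> \<open>The value -1 on the edge vectors from \<open>v\<close> makes
      \<open>1 + f (w - v)\<close> vanish at the other vertices; \<open>adjoint f 1\<close> is the
      vector representing \<open>f\<close>.\<close>
    then obtain f :: "'a \<Rightarrow> real" where f: "linear f" "\<forall>y \<in> (\<lambda>x. x - v) ` (S - {v}). f y = - 1"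
      using linear_independent_extend[of _ "\<lambda>_. - 1 :: real"] by blast
    have "f y = adjoint f 1 \<bullet> y" for y
      using adjoint_clauses(2)[OF f(1), of 1 y] by simp
    then show ?thesis using f(2) by (intro exI[of _ "adjoint f 1"]) auto
  qed
  then obtain g where "\<forall>v\<in>S. \<forall>w\<in>S. 1 + g v \<bullet> (w - v) = (if w = v then 1 else 0)"
    by metis
  then have "simplex_gradients S g"
    using assms(2) by (intro simplex_gradients.intro) auto
  then show ?thesis by blast
qed

text \<open>The two-dimensional faces are exactly the facets, each opposite to a vertex, so the
  projection criterion applies to each of them.\<close>

lemma height_function_simplex_iff:
  fixes S :: "(real^3) set"
  assumes "simplex_gradients S g"
  shows "height_function (convex hull S) \<longleftrightarrow> (\<exists>v\<in>S. \<forall>w\<in>S - {v}. g v \<bullet> g w \<le> 0)"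
proof -
  interpret simplex_gradients S g by fact
  have face: "F face_of convex hull S \<and> aff_dim F = 2 \<longleftrightarrow> (\<exists>v\<in>S. F = convex hull (S - {v}))" for F
  proof -
    have "F face_of convex hull S \<and> aff_dim F = 2 \<longleftrightarrow> F facet_of convex hull S"
      using aff_dim_vertices aff_dim_convex_hull[of S] by (auto simp: facet_of_def)
    also have "\<dots> \<longleftrightarrow> F \<noteq> {} \<and> (\<exists>v\<in>S. F = convex hull (S - {v}))"
      using facet_of_convex_hull_affine_independent[OF affine_independent] by blast
    also have "\<dots> \<longleftrightarrow> (\<exists>v\<in>S. F = convex hull (S - {v}))"
      using card_vertices finite_vertices by (auto simp: subset_singleton_iff)
    finally show ?thesis .
  qed
  have "polyhedron (convex hull S)"
    by (simp add: finite_vertices polytope_convex_hull polytope_imp_polyhedron)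
  then have "height_function (convex hull S) \<longleftrightarrow>
      (\<exists>v\<in>S. closest_point (affine hull (convex hull (S - {v}))) ` (convex hull S)
        \<subseteq> convex hull (S - {v}))"
    unfolding height_function_def using face by metis
  then show ?thesis by (simp add: closest_point_facet_image_subset_iff)
qed

subsection \<open>Dihedral angles\<close>

lemma (in simplex_gradients) gradient_inner_diff:
  assumes "v \<in> S" "w \<in> S" "u \<in> S"
  shows "g v \<bullet> (w - u) = (if w = v then 1 else 0) - (if u = v then 1 else 0)"
  using gradient_vertex[OF assms(1,2)] gradient_vertex[OF assms(1,3)]
  by (auto simp: inner_diff_right)

text \<open>The edge vector \<open>w - u\<close> is orthogonal to \<open>g v\<close> but not to
  \<open>g w\<close>. This makes Cauchy-Schwarz strict for two gradients.\<close>

lemma (in simplex_gradients) gradients_not_parallel: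
  assumes "v \<in> S" "w \<in> S" "u \<in> S" "v \<noteq> w" "u \<noteq> v" "u \<noteq> w"
  shows "g w \<noteq> k *\<^sub>R g v"
proof
  assume "g w = k *\<^sub>R g v"
  then have "g w \<bullet> (w - u) = k * (g v \<bullet> (w - u))" by simp
  then show False using assms by (simp add: gradient_inner_diff)
qed

lemma inner_power2_less:
  fixes x y :: "'a::real_inner"
  assumes "x \<noteq> 0" "\<And>k. y \<noteq> k *\<^sub>R x"
  shows "(x \<bullet> y)\<^sup>2 < (x \<bullet> x) * (y \<bullet> y)"
proof -
  have pos: "x \<bullet> x > 0" using assms(1) by simp
  \<comment> \<open>\<open>z\<close> is the component of \<open>y\<close> orthogonal to
    \<open>x\<close>, scaled by \<open>x \<bullet> x\<close> to avoid division.\<close>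
  define z where "z = (x \<bullet> x) *\<^sub>R y - (x \<bullet> y) *\<^sub>R x"
  have "z \<noteq> 0"
  proof
    assume "z = 0"
    then have "(1 / (x \<bullet> x)) *\<^sub>R ((x \<bullet> x) *\<^sub>R y) = (1 / (x \<bullet> x)) *\<^sub>R ((x \<bullet> y) *\<^sub>R x)"
      by (simp add: z_def)
    then show False using pos assms(2)[of "1 / (x \<bullet> x) * (x \<bullet> y)"] by simp
  qed
  then have "0 < z \<bullet> z" by simp
  also have "z \<bullet> z = (x \<bullet> x) * ((x \<bullet> x) * (y \<bullet> y) - (x \<bullet> y)\<^sup>2)"
    by (simp add: z_def inner_diff_left inner_diff_right inner_commute[of y x] power2_eq_square algebra_simps)
  finally show ?thesis using pos by (simp add: zero_less_mult_iff)
qed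

lemma card_4_distinct: "card {a, b, c, d} = 4 \<Longrightarrow> distinct [a, b, c, d]"
  using card_distinct[of "[a, b, c, d]"] by simp

locale tetrahedron_gradients = simplex_gradients "{a, b, c, d}" g for a b c d :: "real^3" and g
begin

lemma vertices_distinct: "distinct [a, b, c, d]"
  using card_vertices by (intro card_4_distinct) simp

lemma bary_at:
  "bary a a = 1" "bary a b = 0" "bary a c = 0" "bary a d = 0"
  "bary b a = 0" "bary b b = 1" "bary b c = 0" "bary b d = 0"
  "bary c a = 0" "bary c b = 0" "bary c c = 1" "bary c d = 0"
  "bary d a = 0" "bary d b = 0" "bary d c = 0" "bary d d = 1"
  using vertices_distinct by (auto simp: bary_vertex)

lemma gradient_sum4: "g a + g b + g c + g d = 0"
  using sum_gradients vertices_distinct by (simp add: add.assoc)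

text \<open>A vector on which \<open>g c\<close> and \<open>g d\<close> vanish is parallel to
  \<open>a - b\<close>, by \<open>gradient_combination\<close> and the vanishing sum of the
  gradients.\<close>

lemma orthogonal_edge_eq_0:
  assumes "u \<bullet> (a - b) = 0" "g c \<bullet> u = 0" "g d \<bullet> u = 0"
  shows "u = 0"
proof -
  have "(g a + g b + g c + g d) \<bullet> u = 0" by (simp add: gradient_sum4)
  then have b: "g b \<bullet> u = - (g a \<bullet> u)" using assms by (simp add: inner_add_left)
  have "u = (g a \<bullet> u) *\<^sub>R a + (g b \<bullet> u) *\<^sub>R b + (g c \<bullet> u) *\<^sub>R c + (g d \<bullet> u) *\<^sub>R d"
    using gradient_combination[of u] vertices_distinct by (simp add: add.assoc)
  then have u: "u = (g a \<bullet> u) *\<^sub>R (a - b)" using assms b by (simp add: algebra_simps)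
  have "u \<bullet> u = 0" by (subst u) (simp add: assms(1) inner_commute[of _ u])
  then show ?thesis by simp
qed

lemma conormal_unique:
  assumes "norm u = 1" "u \<bullet> (a - b) = 0" "g c \<bullet> u = 0" "g d \<bullet> u \<ge> 0"
    and "norm w = 1" "w \<bullet> (a - b) = 0" "g c \<bullet> w = 0" "g d \<bullet> w \<ge> 0"
  shows "u = w"
proof -
  have pos: "g d \<bullet> u > 0" "g d \<bullet> w > 0"
    using assms orthogonal_edge_eq_0[of u] orthogonal_edge_eq_0[of w]
    by (metis norm_zero zero_neq_one le_less)+
  \<comment> \<open>This combination is also annihilated by \<open>g d\<close>, so \<open>u\<close>
    and \<open>w\<close> are positive multiples of each other; their norms agree.\<close>
  have "(g d \<bullet> w) *\<^sub>R u - (g d \<bullet> u) *\<^sub>R w = 0"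
    by (rule orthogonal_edge_eq_0) (use assms in \<open>simp_all add: inner_diff_left inner_diff_right\<close>)
  then have eq: "(g d \<bullet> w) *\<^sub>R u = (g d \<bullet> u) *\<^sub>R w" by simp
  then have "norm ((g d \<bullet> w) *\<^sub>R u) = norm ((g d \<bullet> u) *\<^sub>R w)" by simp
  then have "g d \<bullet> w = g d \<bullet> u" using pos assms by simp
  then have "(g d \<bullet> u) *\<^sub>R u = (g d \<bullet> u) *\<^sub>R w" using eq by (simp only:)
  then show ?thesis using pos by (metis less_irrefl real_vector.scale_left_imp_eq)
qed

lemma facet_conormal:
  assumes "g c \<bullet> u = 0" "g d \<bullet> u > 0" "u \<bullet> (a - b) = 0" "norm u = 1"
  shows "conormal (convex hull {a, b}) (convex hull {a, b, d}) = u"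
  unfolding conormal_def
proof (rule the_equality)
  have mem: "x \<in> convex hull {a, b, d} \<longleftrightarrow> bary a x \<ge> 0 \<and> bary b x \<ge> 0 \<and> bary c x = 0 \<and> bary d x \<ge> 0"
    for x using mem_hull_subset_iff[of "{a, b, d}"] vertices_distinct by auto
  have mem_edge: "bary c x = 0" "bary d x = 0" if "x \<in> convex hull {a, b}" for x
    using that mem_hull_subset_iff[of "{a, b}"] vertices_distinct by auto
  have perp: "u \<bullet> (x - y) = 0"
    if "u \<bullet> (a - b) = 0" "x \<in> convex hull {a, b}" "y \<in> convex hull {a, b}" for u x y
  proof -
    obtain s t where "x = (1 - s) *\<^sub>R a + s *\<^sub>R b" "y = (1 - t) *\<^sub>R a + t *\<^sub>R b"
      using \<open>x \<in> _\<close> \<open>y \<in> _\<close> by (auto simp: in_segment simp flip: segment_convex_hull)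
    moreover have "((1 - s) *\<^sub>R a + s *\<^sub>R b) - ((1 - t) *\<^sub>R a + t *\<^sub>R b) = (t - s) *\<^sub>R (a - b)"
      by (simp add: algebra_simps)
    ultimately have "x - y = (t - s) *\<^sub>R (a - b)" by (simp only:)
    then show ?thesis using that(1) by simp
  qed
  have "midpoint a b \<in> rel_interior (convex hull {a, b})"
    using vertices_distinct rel_interior_closed_segment[of a b]
    by (simp add: segment_convex_hull)
  moreover
  \<comment> \<open>\<open>s\<close> bounds the rates at which \<open>bary a\<close> and
    \<open>bary b\<close> change along \<open>u\<close>. Both are 1/2 at the midpoint, so a step of
    length \<open>1 / (2 * s)\<close> keeps them nonnegative.\<close>
  define s where "s = \<bar>g a \<bullet> u\<bar> + \<bar>g b \<bullet> u\<bar> + 1"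
  have s: "s > 0" "\<bar>g a \<bullet> u\<bar> \<le> s" "\<bar>g b \<bullet> u\<bar> \<le> s" by (auto simp: s_def)
  define t where "t = 1 / (2 * s)"
  have t: "t > 0" "t * s = 1 / 2" using s by (auto simp: t_def)
  have "t * y \<ge> - (1/2)" if "\<bar>y\<bar> \<le> s" for y
    using mult_left_mono[of "- s" y t] that t by auto
  then have "t * (g a \<bullet> u) \<ge> - (1/2)" "t * (g b \<bullet> u) \<ge> - (1/2)"
    using s by blast+
  moreover have mid: "bary v (midpoint a b) = (bary v a + bary v b) / 2" for v
    by (simp add: bary_def midpoint_def inner_diff_right inner_add_right field_simps)
  have "bary a (midpoint a b) = 1 / 2" "bary b (midpoint a b) = 1 / 2"
    "bary c (midpoint a b) = 0" "bary d (midpoint a b) = 0"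
    unfolding mid by (simp_all add: bary_at)
  ultimately have "midpoint a b + t *\<^sub>R u \<in> convex hull {a, b, d}"
    using assms t unfolding mem bary_add by simp
  then show "norm u = 1 \<and> (\<forall>x\<in>convex hull {a, b}. \<forall>y\<in>convex hull {a, b}. u \<bullet> (x - y) = 0) \<and>
    (\<exists>x\<in>rel_interior (convex hull {a, b}). \<exists>t>0. x + t *\<^sub>R u \<in> convex hull {a, b, d})"
    using assms(3,4) perp t \<open>midpoint a b \<in> _\<close> by blast
  fix w
  assume w: "norm w = 1 \<and> (\<forall>x\<in>convex hull {a, b}. \<forall>y\<in>convex hull {a, b}. w \<bullet> (x - y) = 0) \<and>
    (\<exists>x\<in>rel_interior (convex hull {a, b}). \<exists>t>0. x + t *\<^sub>R w \<in> convex hull {a, b, d})"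
  then obtain x t where x: "x \<in> convex hull {a, b}" and t: "t > 0"
    and "x + t *\<^sub>R w \<in> convex hull {a, b, d}"
    using rel_interior_subset by blast
  then have "bary c (x + t *\<^sub>R w) = 0" "bary d (x + t *\<^sub>R w) \<ge> 0" by (auto simp: mem)
  then have "g c \<bullet> w = 0" "g d \<bullet> w \<ge> 0"
    using t mem_edge[OF x] by (auto simp: bary_add zero_le_mult_iff)
  moreover have "w \<bullet> (a - b) = 0" using w by (simp add: hull_inc)
  ultimately show "w = u"
    using w assms by (intro conormal_unique) auto
qed

text \<open>Up to scaling, the conormal is the component of \<open>g d\<close> orthogonal to
  \<open>g c\<close>: both gradients are orthogonal to the edge, and strict Cauchy-Schwarz makes
  this component point into the facet.\<close>

lemma conormal_eq:
  "conormal (convex hull {a, b}) (convex hull {a, b, d}) = sgn ((g c \<bullet> g c) *\<^sub>R g d - (g c \<bullet> g d) *\<^sub>R g c)"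
    (is "_ = sgn ?w")
proof (rule facet_conormal)
  have par: "g d \<noteq> k *\<^sub>R g c" for k
    using vertices_distinct by (intro gradients_not_parallel[where u = a]) auto
  have less: "(g c \<bullet> g d)\<^sup>2 < (g c \<bullet> g c) * (g d \<bullet> g d)"
    using par gradient_nonzero by (intro inner_power2_less) auto
  show "g c \<bullet> sgn ?w = 0"
    by (simp add: sgn_div_norm inner_diff_right)
  have d: "g d \<bullet> ?w > 0"
    using less by (simp add: inner_diff_right inner_commute[of "g d" "g c"] power2_eq_square)
  then have "?w \<noteq> 0" by auto
  then show "norm (sgn ?w) = 1" by (simp add: norm_sgn)
  show "g d \<bullet> sgn ?w > 0"
    using d \<open>?w \<noteq> 0\<close> by (simp only: sgn_div_norm inner_scaleR_right) simp
  have "g c \<bullet> (a - b) = 0" "g d \<bullet> (a - b) = 0"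
    using vertices_distinct by (simp_all add: gradient_inner_diff)
  then show "sgn ?w \<bullet> (a - b) = 0"
    by (simp add: sgn_div_norm inner_diff_left)
qed

lemma swap_cd: "tetrahedron_gradients a b d c g"
  using simplex_gradients_axioms by (simp add: tetrahedron_gradients_def insert_commute)

text \<open>Exactly two facets contain the edge, and their order is irrelevant because the inner
  product is symmetric; this justifies the definite description.\<close>

lemma dihedral_angle_eq:
  "dihedral_angle (convex hull {a, b, c, d}) (convex hull {a, b}) =
    arccos (conormal (convex hull {a, b}) (convex hull {a, b, c}) \<bullet>
            conormal (convex hull {a, b}) (convex hull {a, b, d}))"
  unfolding dihedral_angle_def
proof (rule the_equality)
  let ?S = "{a, b, c, d}"
  have facet: "F facet_of convex hull ?S \<and> convex hull {a, b} \<subseteq> F \<longleftrightarrow>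
      F = convex hull {a, b, c} \<or> F = convex hull {a, b, d}" for F
  proof
    assume F: "F facet_of convex hull ?S \<and> convex hull {a, b} \<subseteq> F"
    then obtain v where v: "v \<in> ?S" "F = convex hull (?S - {v})"
      using facet_of_convex_hull_affine_independent[OF affine_independent] by blast
    have "a \<in> F" "b \<in> F" using F hull_subset[of "{a, b}" convex] by blast+
    then have "bary v a = 0" "bary v b = 0"
      using v mem_hull_subset_iff[of "?S - {v}"] by auto
    then have "v = c \<or> v = d" using v(1) by (auto simp: bary_at)
    moreover have "?S - {c} = {a, b, d}" "?S - {d} = {a, b, c}" using vertices_distinct by auto
    ultimately show "F = convex hull {a, b, c} \<or> F = convex hull {a, b, d}" using v(2) by metis
  next
    have "convex hull (?S - {v}) facet_of convex hull ?S" if "v \<in> {c, d}" for v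
      using that facet_of_convex_hull_affine_independent[OF affine_independent] vertices_distinct
      by (auto simp: subset_singleton_iff)
    moreover have "?S - {c} = {a, b, d}" "?S - {d} = {a, b, c}" using vertices_distinct by auto
    ultimately have "convex hull {a, b, c} facet_of convex hull ?S"
      "convex hull {a, b, d} facet_of convex hull ?S"
      by (metis insertI1 insert_subset subset_insertI)+
    moreover assume "F = convex hull {a, b, c} \<or> F = convex hull {a, b, d}"
    moreover have "convex hull {a, b} \<subseteq> convex hull {a, b, c}" "convex hull {a, b} \<subseteq> convex hull {a, b, d}"
      by (auto intro!: hull_mono)
    ultimately show "F facet_of convex hull ?S \<and> convex hull {a, b} \<subseteq> F" by blast
  qed
  have ne: "convex hull {a, b, c} \<noteq> convex hull {a, b, d}"
  proof
    assume "convex hull {a, b, c} = convex hull {a, b, d}"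
    then have "c \<in> convex hull {a, b, d}" by (metis hull_inc insertI1 insert_commute)
    then have "bary c c = 0" using mem_hull_subset_iff[of "{a, b, d}"] vertices_distinct by auto
    then show False by (simp add: bary_at)
  qed
  let ?\<theta> = "arccos (conormal (convex hull {a, b}) (convex hull {a, b, c}) \<bullet>
    conormal (convex hull {a, b}) (convex hull {a, b, d}))"
  show "\<exists>F G. F facet_of convex hull ?S \<and> G facet_of convex hull ?S \<and> F \<noteq> G \<and>
      convex hull {a, b} \<subseteq> F \<and> convex hull {a, b} \<subseteq> G \<and>
      ?\<theta> = arccos (conormal (convex hull {a, b}) F \<bullet> conormal (convex hull {a, b}) G)"
    using facet ne by blast
  fix \<theta>
  assume "\<exists>F G. F facet_of convex hull ?S \<and> G facet_of convex hull ?S \<and> F \<noteq> G \<and>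
      convex hull {a, b} \<subseteq> F \<and> convex hull {a, b} \<subseteq> G \<and>
      \<theta> = arccos (conormal (convex hull {a, b}) F \<bullet> conormal (convex hull {a, b}) G)"
  then show "\<theta> = ?\<theta>" using facet by (metis inner_commute)
qed

text \<open>The inner product of the unnormalised conormals is \<open>- (g c \<bullet> g d)\<close>
  times the Gram determinant of \<open>g c\<close> and \<open>g d\<close>, which is
  nonnegative.\<close>

lemma obtuse_imp_gradients:
  assumes "dihedral_angle (convex hull {a, b, c, d}) (convex hull {a, b}) > pi / 2"
  shows "g c \<bullet> g d > 0"
proof -
  interpret s: tetrahedron_gradients a b d c g by (rule swap_cd)
  let ?w = "(g c \<bullet> g c) *\<^sub>R g d - (g c \<bullet> g d) *\<^sub>R g c"
  let ?w' = "(g d \<bullet> g d) *\<^sub>R g c - (g d \<bullet> g c) *\<^sub>R g d"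
  let ?y = "sgn ?w' \<bullet> sgn ?w"
  have "\<bar>?y\<bar> \<le> norm (sgn ?w') * norm (sgn ?w)" by (rule Cauchy_Schwarz_ineq2)
  also have "\<dots> \<le> 1" by (simp add: norm_sgn)
  finally have "?y \<le> 1" by simp
  have "arccos ?y > pi / 2"
    using assms unfolding dihedral_angle_eq conormal_eq s.conormal_eq .
  then have "?y < 0" using arccos_le_pi2[of ?y] \<open>?y \<le> 1\<close> by linarith
  then have "?w' \<bullet> ?w < 0"
    by (simp only: sgn_div_norm inner_scaleR_left inner_scaleR_right)
      (metis inverse_nonnegative_iff_nonnegative mult_nonneg_nonneg norm_ge_zero not_le)
  also have "?w' \<bullet> ?w = - ((g c \<bullet> g d) * ((g c \<bullet> g c) * (g d \<bullet> g d) - (g c \<bullet> g d)\<^sup>2))"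
    by (simp add: inner_diff_left inner_diff_right inner_commute[of "g d" "g c"] power2_eq_square algebra_simps)
  finally have "(g c \<bullet> g d) * ((g c \<bullet> g c) * (g d \<bullet> g d) - (g c \<bullet> g d)\<^sup>2) > 0" by simp
  moreover have "(g c \<bullet> g d)\<^sup>2 \<le> (g c \<bullet> g c) * (g d \<bullet> g d)" by (rule Cauchy_Schwarz_ineq)
  ultimately show ?thesis by (simp add: zero_less_mult_iff)
qed

end

subsection \<open>Pieces of a subdivided tetrahedron\<close>

lemma orthogonal_imp_scaled:
  fixes m n :: "'a::real_inner"
  assumes "\<And>y. m \<bullet> y = 0 \<Longrightarrow> n \<bullet> y = 0"
  obtains k where "n = k *\<^sub>R m"
proof (cases "m = 0")
  case True
  then have "n = 0" using assms[of n] by simp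
  then show ?thesis using that[of 0] by simp
next
  case False
  define k where "k = (m \<bullet> n) / (m \<bullet> m)"
  \<comment> \<open>The part of \<open>n\<close> orthogonal to \<open>m\<close> is orthogonal to
    \<open>n\<close> as well, hence to itself.\<close>
  have "m \<bullet> (n - k *\<^sub>R m) = 0" using False by (simp add: k_def inner_diff_right)
  moreover from this have "n \<bullet> (n - k *\<^sub>R m) = 0" by (rule assms)
  ultimately have "(n - k *\<^sub>R m) \<bullet> (n - k *\<^sub>R m) = 0" by (simp only: inner_diff_left inner_scaleR_left)
  then show ?thesis using that[of k] by simp
qed

text \<open>The definition provides some normal of the plane, which must be a nonzero multiple of
  \<open>m\<close>; its sign decides the order of the pieces. As the pieces cover \<open>T\<close>
  and meet in the plane, each is a full half of \<open>T\<close>.\<close>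

lemma tetrahedral_subdivision_halves:
  assumes sub: "tetrahedral_subdivision {x. m \<bullet> x = k} T T0 T1" and "m \<bullet> p = k"
  shows "T0 = {x \<in> T. m \<bullet> x \<ge> k} \<and> T1 = {x \<in> T. m \<bullet> x \<le> k} \<or>
         T0 = {x \<in> T. m \<bullet> x \<le> k} \<and> T1 = {x \<in> T. m \<bullet> x \<ge> k}"
proof -
  obtain n c where n: "n \<noteq> 0" and H: "{x. m \<bullet> x = k} = {x. n \<bullet> x = c}"
    and sides: "T0 \<subseteq> {x. n \<bullet> x \<le> c}" "T1 \<subseteq> {x. n \<bullet> x \<ge> c}"
    using sub unfolding tetrahedral_subdivision_def by blast
  have T: "T = T0 \<union> T1" "T0 \<inter> T1 = {x \<in> T. m \<bullet> x = k}"
    using sub unfolding tetrahedral_subdivision_def by blast+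
  have p: "n \<bullet> p = c" using H \<open>m \<bullet> p = k\<close> by blast
  have "n \<bullet> y = 0" if "m \<bullet> y = 0" for y
  proof -
    have "p + y \<in> {x. m \<bullet> x = k}" using that \<open>m \<bullet> p = k\<close> by (simp add: inner_add_right)
    then show ?thesis using p unfolding H by (simp add: inner_add_right)
  qed
  then obtain r where r: "n = r *\<^sub>R m" by (rule orthogonal_imp_scaled)
  then have "r \<noteq> 0" using n by auto
  have side: "n \<bullet> x - c = r * (m \<bullet> x - k)" for x
  proof -
    have "n \<bullet> x - c = n \<bullet> x - n \<bullet> p" using p by simp
    also have "\<dots> = r * (m \<bullet> x - m \<bullet> p)" unfolding r by (simp add: right_diff_distrib)
    finally show ?thesis using \<open>m \<bullet> p = k\<close> by simp
  qed
  show ?thesis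
  proof (cases "r > 0")
    case True
    then have "n \<bullet> x - c \<le> 0 \<longleftrightarrow> m \<bullet> x - k \<le> 0" "n \<bullet> x - c \<ge> 0 \<longleftrightarrow> m \<bullet> x - k \<ge> 0" for x
      unfolding side by (auto simp: mult_le_0_iff zero_le_mult_iff)
    then have "n \<bullet> x \<le> c \<longleftrightarrow> m \<bullet> x \<le> k" "n \<bullet> x \<ge> c \<longleftrightarrow> m \<bullet> x \<ge> k" for x
      by simp_all
    then have "\<forall>x\<in>T0. m \<bullet> x \<le> k" "\<forall>x\<in>T1. m \<bullet> x \<ge> k" using sides by blast+
    then have "T0 = {x \<in> T. m \<bullet> x \<le> k}" "T1 = {x \<in> T. m \<bullet> x \<ge> k}"
      using T by (fastforce simp: set_eq_iff)+
    then show ?thesis by blast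
  next
    case False
    then have "n \<bullet> x - c \<le> 0 \<longleftrightarrow> m \<bullet> x - k \<ge> 0" "n \<bullet> x - c \<ge> 0 \<longleftrightarrow> m \<bullet> x - k \<le> 0" for x
      using \<open>r \<noteq> 0\<close> unfolding side by (auto simp: mult_le_0_iff zero_le_mult_iff)
    then have "n \<bullet> x \<le> c \<longleftrightarrow> m \<bullet> x \<ge> k" "n \<bullet> x \<ge> c \<longleftrightarrow> m \<bullet> x \<le> k" for x
      by simp_all
    then have "\<forall>x\<in>T0. m \<bullet> x \<ge> k" "\<forall>x\<in>T1. m \<bullet> x \<le> k" using sides by blast+
    then have "T0 = {x \<in> T. m \<bullet> x \<ge> k}" "T1 = {x \<in> T. m \<bullet> x \<le> k}"
      using T by (fastforce simp: set_eq_iff)+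
    then show ?thesis by blast
  qed
qed

lemma affine_hull_convex_hull_Un: "affine hull (convex hull A \<union> B) = affine hull (A \<union> B)"
proof (rule hull_unique)
  have "convex hull A \<subseteq> affine hull A" by (rule convex_hull_subset_affine_hull)
  also have "\<dots> \<subseteq> affine hull (A \<union> B)" by (intro hull_mono) simp
  finally show "convex hull A \<union> B \<subseteq> affine hull (A \<union> B)"
    using hull_subset[of "A \<union> B" affine] by blast
  fix C assume "convex hull A \<union> B \<subseteq> C" "affine C"
  then show "affine hull (A \<union> B) \<subseteq> C"
    using hull_subset[of A convex] by (intro hull_minimal) auto
qed (rule affine_affine_hull)

lemma (in simplex_gradients) gradient_inner_bary: "g v \<bullet> (x - y) = bary v x - bary v y"
  by (simp add: bary_def inner_diff_right)

lemma (in tetrahedron_gradients) swap_ab: "tetrahedron_gradients b a c d g"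
  using simplex_gradients_axioms by (simp add: tetrahedron_gradients_def insert_commute)

lemma (in tetrahedron_gradients) swap_edges: "tetrahedron_gradients c d a b g"
  using simplex_gradients_axioms by (simp add: tetrahedron_gradients_def insert_commute)

lemma (in tetrahedron_gradients) tetrahedron_hull: "tetrahedron (convex hull {a, b, c, d})"
  unfolding simplex_def
  by (rule exI[of _ "{a, b, c, d}"]) (use affine_independent card_vertices in simp)

text \<open>The tetrahedron lies on one side of a facet plane, so one piece would lie in the plane
  and have dimension at most 2.\<close>

lemma (in tetrahedron_gradients) no_subdivision_through_facet:
  "\<not> tetrahedral_subdivision (affine hull {a, c, d}) (convex hull {a, b, c, d}) T0 T1"
proof
  let ?T = "convex hull {a, b, c, d}"
  assume sub: "tetrahedral_subdivision (affine hull {a, c, d}) ?T T0 T1"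
  have "{a, c, d} = {a, b, c, d} - {b}" using vertices_distinct by auto
  moreover have "bary b x = 0 \<longleftrightarrow> g b \<bullet> x = g b \<bullet> a" for x
    using gradient_inner_bary[of b x a] by (auto simp: bary_at inner_diff_right)
  ultimately have H: "affine hull {a, c, d} = {x. g b \<bullet> x = g b \<bullet> a}"
    using mem_affine_hull_facet_iff[of b] by auto
  have "g b \<bullet> x \<ge> g b \<bullet> a" if "x \<in> ?T" for x
    using that gradient_inner_bary[of b x a] by (simp add: mem_hull_iff bary_at inner_diff_right)
  then have "{x \<in> ?T. g b \<bullet> x \<le> g b \<bullet> a} \<subseteq> {x. g b \<bullet> x = g b \<bullet> a}" by fastforce
  then have "T0 \<subseteq> {x. g b \<bullet> x = g b \<bullet> a} \<or> T1 \<subseteq> {x. g b \<bullet> x = g b \<bullet> a}"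
    using tetrahedral_subdivision_halves[of "g b" "g b \<bullet> a" ?T T0 T1 a] sub unfolding H by blast
  then have "aff_dim T0 \<le> aff_dim {x. g b \<bullet> x = g b \<bullet> a} \<or> aff_dim T1 \<le> aff_dim {x. g b \<bullet> x = g b \<bullet> a}"
    using aff_dim_subset by blast
  moreover have "aff_dim T0 = 3" "aff_dim T1 = 3"
    using sub aff_dim_simplex unfolding tetrahedral_subdivision_def by blast+
  moreover have "aff_dim {x. g b \<bullet> x = g b \<bullet> a} = 2"
    using gradient_nonzero[of b] by simp
  ultimately show False by simp
qed

section \<open>The pieces cut off by the plane through \<open>c\<close>, \<open>d\<close> and an
  inner point of \<open>ab\<close>\<close>

locale split_tetrahedron = tetrahedron_gradients +
  fixes t :: real
  assumes t: "0 < t" "t < 1"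
begin

definition p where "p = (1 - t) *\<^sub>R a + t *\<^sub>R b"

text \<open>The gradient of an affine function that vanishes on the plane through \<open>p\<close>, \<open>c\<close> and \<open>d\<close>.\<close>

definition m where "m = t *\<^sub>R g a - (1 - t) *\<^sub>R g b"

lemma bary_p: "bary v p = (1 - t) * bary v a + t * bary v b"
  by (simp add: bary_def p_def inner_diff_right inner_add_right algebra_simps)

lemma p_bary: "bary a p = 1 - t" "bary b p = t" "bary c p = 0" "bary d p = 0"
  by (simp_all add: bary_p bary_at)

lemma p_not_vertex: "p \<notin> {a, b, c, d}"
  using p_bary bary_at t by auto

lemma m_inner_diff: "m \<bullet> (x - y) = t * (bary a x - bary a y) - (1 - t) * (bary b x - bary b y)"
  by (simp add: m_def inner_diff_left gradient_inner_bary)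

text \<open>The gradients of the piece \<open>apcd\<close>. The functions with gradients
  \<open>m\<close> and \<open>g b\<close> that vanish on the facets opposite to \<open>a\<close> and
  \<open>p\<close> take the value \<open>t\<close> at these vertices, hence the factor
  \<open>1 / t\<close>.\<close>

definition h where "h v = (if v = a then (1 / t) *\<^sub>R m else if v = p then (1 / t) *\<^sub>R g b else g v)"

lemma h_eq: "h a = (1 / t) *\<^sub>R m" "h p = (1 / t) *\<^sub>R g b" "h c = g c" "h d = g d"
  using vertices_distinct p_not_vertex by (auto simp: h_def)

lemma m_inner_p: "m \<bullet> (x - p) = t * bary a x - (1 - t) * bary b x"
  unfolding m_inner_diff p_bary by (simp add: algebra_simps)

lemma h_inner:
  "1 + h a \<bullet> (x - a) = (t * bary a x - (1 - t) * bary b x) / t"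
  "1 + h p \<bullet> (x - p) = bary b x / t"
  "1 + h c \<bullet> (x - c) = bary c x"
  "1 + h d \<bullet> (x - d) = bary d x"
  unfolding h_eq inner_scaleR_left m_inner_diff gradient_inner_bary p_bary bary_at
  using t by (simp_all add: diff_divide_distrib right_diff_distrib)

sublocale piece: tetrahedron_gradients a p c d h
proof
  show "card {a, p, c, d} = DIM(real^3) + 1"
    using p_not_vertex vertices_distinct by auto
next
  fix v w assume v: "v \<in> {a, p, c, d}" and w: "w \<in> {a, p, c, d}"
  have ne: "a \<noteq> p" "c \<noteq> p" "d \<noteq> p" "a \<noteq> c" "a \<noteq> d" "c \<noteq> d"
    using p_not_vertex vertices_distinct by auto
  note ne = ne ne[symmetric]
  have "w = a \<or> w = p \<or> w = c \<or> w = d" using w by blast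
  then have "1 + h a \<bullet> (w - a) = (if w = a then 1 else 0)"
    "1 + h p \<bullet> (w - p) = (if w = p then 1 else 0)"
    "1 + h c \<bullet> (w - c) = (if w = c then 1 else 0)"
    "1 + h d \<bullet> (w - d) = (if w = d then 1 else 0)"
    unfolding h_inner using t by (elim disjE; simp add: ne bary_at p_bary)+
  then show "1 + h v \<bullet> (w - v) = (if w = v then 1 else 0)"
    using v by blast
qed

lemma piece_bary:
  "piece.bary a x = m \<bullet> (x - p) / t" "piece.bary p x = bary b x / t"
  "piece.bary c x = bary c x" "piece.bary d x = bary d x"
  unfolding piece.bary_def h_inner m_inner_p by simp_all

lemma plane_eq: "affine hull (convex hull {c, d} \<union> {p}) = {x. m \<bullet> x = m \<bullet> p}"
proof -
  have "{c, d} \<union> {p} = {a, p, c, d} - {a}" using p_not_vertex vertices_distinct by auto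
  then have "affine hull (convex hull {c, d} \<union> {p}) = affine hull ({a, p, c, d} - {a})"
    unfolding affine_hull_convex_hull_Un by (rule arg_cong)
  also have "\<dots> = {x. piece.bary a x = 0}"
    using piece.mem_affine_hull_facet_iff[of a] by blast
  also have "\<dots> = {x. m \<bullet> x = m \<bullet> p}"
    using t by (simp add: piece_bary inner_diff_right)
  finally show ?thesis .
qed

lemma piece_eq: "convex hull {a, p, c, d} = {x \<in> convex hull {a, b, c, d}. m \<bullet> x \<ge> m \<bullet> p}"
proof -
  have "x \<in> convex hull {a, p, c, d} \<longleftrightarrow> x \<in> convex hull {a, b, c, d} \<and> m \<bullet> (x - p) \<ge> 0" for x
  proof -
    \<comment> \<open>On this side of the plane \<open>t * bary a x\<close> is at least
      \<open>(1 - t) * bary b x\<close>.\<close>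
    have "bary a x \<ge> 0" if "bary b x \<ge> 0" "m \<bullet> (x - p) \<ge> 0"
      using that t m_inner_p[of x] by (smt (verit) mult_nonneg_nonneg mult_pos_neg)
    then show ?thesis
      using t by (auto simp: mem_hull_iff piece.mem_hull_iff piece_bary zero_le_divide_iff)
  qed
  then show ?thesis by (auto simp: inner_diff_right)
qed

text \<open>The assumption excludes the facets opposite to \<open>c\<close> and \<open>d\<close>.
  The disjunction stands for the vertices \<open>a\<close> and \<open>p\<close>, whose conditions
  share \<open>m \<bullet> g b \<le> 0\<close>.\<close>

lemma height_function_piece_iff:
  assumes "g c \<bullet> g d > 0"
  shows "height_function (convex hull {a, p, c, d}) \<longleftrightarrow> m \<bullet> g b \<le> 0 \<and>
    (m \<bullet> g c \<le> 0 \<and> m \<bullet> g d \<le> 0 \<or> g b \<bullet> g c \<le> 0 \<and> g b \<bullet> g d \<le> 0)"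
proof -
  have "{a, p, c, d} - {a} = {p, c, d}" "{a, p, c, d} - {p} = {a, c, d}"
    "{a, p, c, d} - {c} = {a, p, d}" "{a, p, c, d} - {d} = {a, p, c}"
    using p_not_vertex vertices_distinct by auto
  then show ?thesis
    using assms t unfolding height_function_simplex_iff[OF piece.simplex_gradients_axioms]
    by (auto simp: h_eq inner_commute divide_le_0_iff)
qed

end

text \<open>Exchanging \<open>a\<close> and \<open>b\<close> keeps \<open>p\<close> and negates
  \<open>m\<close>, so results on \<open>apcd\<close> carry over to \<open>bpcd\<close>.\<close>

lemma (in split_tetrahedron) swap_split: "split_tetrahedron b a c d g (1 - t)"
  using swap_ab t by (simp add: split_tetrahedron_def split_tetrahedron_axioms_def)

text \<open>By \<open>tetrahedral_subdivision_halves\<close>, every subdivision by this plane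
  consists of these two pieces, in some order.\<close>

lemma (in split_tetrahedron) induces_iff_pieces:
  defines "T \<equiv> convex hull {a, b, c, d}"
  defines "T0 \<equiv> convex hull {a, p, c, d}" and "T1 \<equiv> convex hull {b, p, c, d}"
  shows "induces_height_function_subdivision (affine hull (convex hull {c, d} \<union> {p})) T \<longleftrightarrow>
    height_function T0 \<and> height_function T1"
proof -
  interpret s: split_tetrahedron b a c d g "1 - t" by (rule swap_split)
  have [simp]: "s.p = p" "s.m = - m"
    by (simp_all add: p_def s.p_def m_def s.m_def)
  have T0: "T0 = {x \<in> T. m \<bullet> x \<ge> m \<bullet> p}"
    using piece_eq by (simp add: T0_def T_def)
  have T1: "T1 = {x \<in> T. m \<bullet> x \<le> m \<bullet> p}"
    using s.piece_eq by (simp add: T1_def T_def insert_commute)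
  have H: "affine hull (convex hull {c, d} \<union> {p}) = {x. m \<bullet> x = m \<bullet> p}" by (rule plane_eq)
  have tetra: "tetrahedron T0" "tetrahedron T1"
    using piece.tetrahedron_hull s.piece.tetrahedron_hull by (simp_all add: T0_def T1_def)
  have "m \<noteq> 0" using piece.gradient_nonzero[of a] by (auto simp: h_eq)
  have "m \<bullet> (a - p) > 0" using t by (simp add: m_inner_p bary_at)
  then have "a \<in> T0" "a \<notin> T1"
    by (auto simp: T0_def T1 hull_inc inner_diff_right)
  then have "T0 \<noteq> T1" by blast
  then have "tetrahedral_subdivision {x. m \<bullet> x = m \<bullet> p} T T1 T0"
    using tetra \<open>m \<noteq> 0\<close> unfolding tetrahedral_subdivision_def
    by (intro conjI exI[of _ m] exI[of _ "m \<bullet> p"]) (auto simp: T0 T1)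
  then show ?thesis
    unfolding H induces_height_function_subdivision_def
    using tetrahedral_subdivision_halves[of m "m \<bullet> p" T _ _ p] T0 T1 by metis
qed

subsection \<open>Admissible positions of the plane\<close>

text \<open>For gradients \<open>x\<close>, \<open>y\<close>, \<open>z\<close>, \<open>w\<close> at the vertices \<open>a\<close>, \<open>b\<close>, \<open>c\<close>, \<open>d\<close> with obtuse angles at \<open>ab\<close>
  and \<open>cd\<close>, this says that the plane through \<open>c\<close> and \<open>d\<close> with normal \<open>m\<close> cuts the
  tetrahedron into two height functions.\<close>

definition cuts_heights :: "'a::real_inner \<Rightarrow> 'a \<Rightarrow> 'a \<Rightarrow> 'a \<Rightarrow> 'a \<Rightarrow> bool" where
  "cuts_heights x y z w m \<longleftrightarrow>
    m \<bullet> y \<le> 0 \<and> (m \<bullet> z \<le> 0 \<and> m \<bullet> w \<le> 0 \<or> y \<bullet> z \<le> 0 \<and> y \<bullet> w \<le> 0) \<and>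
    m \<bullet> x \<ge> 0 \<and> (m \<bullet> z \<ge> 0 \<and> m \<bullet> w \<ge> 0 \<or> x \<bullet> z \<le> 0 \<and> x \<bullet> w \<le> 0)"

lemma cuts_heights_scale: "c > 0 \<Longrightarrow> cuts_heights x y z w (c *\<^sub>R m) \<longleftrightarrow> cuts_heights x y z w m"
  by (simp add: cuts_heights_def mult_le_0_iff zero_le_mult_iff)

lemma cuts_heights_swap: "cuts_heights y x z w (- m) \<longleftrightarrow> cuts_heights x y z w m"
  by (auto simp: cuts_heights_def)

lemma cuts_heights_swap_cd: "cuts_heights x y w z m \<longleftrightarrow> cuts_heights x y z w m"
  by (auto simp: cuts_heights_def)

text \<open>For \<open>t < 1\<close>, the normal \<open>t *\<^sub>R x - (1 - t) *\<^sub>R y\<close>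
  is a positive multiple of \<open>r *\<^sub>R x - y\<close> with \<open>r = t / (1 - t)\<close>.
  Two admissible ratios thus give two admissible points.\<close>

definition two_ratios :: "'a::real_inner \<Rightarrow> 'a \<Rightarrow> 'a \<Rightarrow> 'a \<Rightarrow> bool" where
  "two_ratios x y z w \<longleftrightarrow>
    (\<exists>r s. 0 < r \<and> r < s \<and> cuts_heights x y z w (r *\<^sub>R x - y) \<and> cuts_heights x y z w (s *\<^sub>R x - y))"

text \<open>Exchanging \<open>x\<close> and \<open>y\<close> replaces a ratio by its reciprocal and
  reverses the order.\<close>

lemma two_ratios_swap:
  assumes "two_ratios y x z w"
  shows "two_ratios x y z w"
proof -
  obtain r s where rs: "0 < r" "r < s"
    and cuts: "cuts_heights y x z w (r *\<^sub>R y - x)" "cuts_heights y x z w (s *\<^sub>R y - x)"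
    using assms unfolding two_ratios_def by blast
  have "cuts_heights x y z w ((1 / k) *\<^sub>R x - y)"
    if "k > 0" "cuts_heights y x z w (k *\<^sub>R y - x)" for k
  proof -
    have "cuts_heights x y z w (- (k *\<^sub>R y - x))"
      using that(2) cuts_heights_swap[of y x z w "- (k *\<^sub>R y - x)"] by simp
    then have "cuts_heights x y z w ((1 / k) *\<^sub>R (- (k *\<^sub>R y - x)))"
      using that(1) by (subst cuts_heights_scale) simp_all
    then show ?thesis using that(1) by (simp add: scaleR_diff_right)
  qed
  moreover have "0 < 1 / s" "1 / s < 1 / r" using rs by (simp_all add: frac_less2)
  ultimately show ?thesis
    using rs cuts unfolding two_ratios_def by (meson less_trans)
qed

lemma two_ratios_swap_cd: "two_ratios x y w z \<Longrightarrow> two_ratios x y z w"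
  by (simp add: two_ratios_def cuts_heights_swap_cd)

text \<open>An obtuse angle between the facets with gradients \<open>y\<close> and \<open>w\<close> forces an obtuse plane angle in
  the facet with gradient \<open>y\<close>; \<open>key\<close> says that another plane angle of this facet is acute.\<close>

lemma two_ratios_obtuse:
  fixes x y z w :: "'a::real_inner"
  assumes sum: "x + y + z + w = 0" and xy: "x \<bullet> y > 0" and zw: "z \<bullet> w > 0" and yw: "y \<bullet> w > 0"
    and less: "(x \<bullet> y)\<^sup>2 < (x \<bullet> x) * (y \<bullet> y)"
  shows "two_ratios x y z w"
proof -
  have dot: "x \<bullet> v + y \<bullet> v + z \<bullet> v + w \<bullet> v = 0" for v
    using sum by (metis inner_add_left inner_zero_left)
  have pos: "x \<bullet> x > 0" "y \<bullet> y > 0" using xy by auto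
  have ww: "w \<bullet> w \<ge> 0" by simp
  have "x \<bullet> w < 0" using dot[of w] yw zw ww by linarith
  have "y \<bullet> z < 0"
    using dot[of y] xy yw pos inner_commute[of z y] inner_commute[of w y] by linarith
  \<comment> \<open>Substituting \<open>x = - y - z - w\<close> leaves minus a Gram determinant,
    minus a term that is positive by the signs of \<open>z \<bullet> w\<close>,
    \<open>y \<bullet> w\<close> and \<open>y \<bullet> z\<close>.\<close>
  have "(y \<bullet> y) * (x \<bullet> z) - (x \<bullet> y) * (y \<bullet> z) =
      - ((y \<bullet> y) * (z \<bullet> z) - (y \<bullet> z)\<^sup>2) - ((y \<bullet> y) * (z \<bullet> w) - (y \<bullet> w) * (y \<bullet> z))"
  proof -
    have xz: "x \<bullet> z = - (y \<bullet> z) - z \<bullet> z - z \<bullet> w"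
      using dot[of z] by (simp add: inner_commute)
    have xy: "x \<bullet> y = - (y \<bullet> y) - y \<bullet> z - y \<bullet> w"
      using dot[of y] by (simp add: inner_commute)
    show ?thesis unfolding xz xy by (simp add: algebra_simps power2_eq_square)
  qed
  moreover have "(y \<bullet> z)\<^sup>2 \<le> (y \<bullet> y) * (z \<bullet> z)" by (rule Cauchy_Schwarz_ineq)
  moreover have "(y \<bullet> y) * (z \<bullet> w) > 0" using pos zw by simp
  moreover have "(y \<bullet> w) * (y \<bullet> z) < 0" using yw \<open>y \<bullet> z < 0\<close> by (rule mult_pos_neg)
  ultimately have key: "(y \<bullet> y) * (x \<bullet> z) < (x \<bullet> y) * (y \<bullet> z)" by linarith
  moreover have "(x \<bullet> y) * (y \<bullet> z) < 0" using xy \<open>y \<bullet> z < 0\<close> by (rule mult_pos_neg)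
  ultimately have "(y \<bullet> y) * (x \<bullet> z) < 0" by linarith
  then have "x \<bullet> z < 0" using pos by (simp add: mult_less_0_iff)
  \<comment> \<open>For \<open>m = k *\<^sub>R x - y\<close>, the bound \<open>k \<le> s\<close> is
    \<open>m \<bullet> y \<le> 0\<close>, and the two terms of \<open>r\<close> encode
    \<open>m \<bullet> x \<ge> 0\<close> and \<open>m \<bullet> z \<le> 0\<close>, where dividing by
    \<open>x \<bullet> z < 0\<close> reverses the inequality. Strict Cauchy-Schwarz and
    \<open>key\<close> give \<open>r < s\<close>.\<close>
  define s where "s = (y \<bullet> y) / (x \<bullet> y)"
  define r where "r = max ((x \<bullet> y) / (x \<bullet> x)) ((y \<bullet> z) / (x \<bullet> z))"
  have "r < s"
  proof -
    have "(x \<bullet> y) / (x \<bullet> x) < s"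
      using less xy pos by (simp add: s_def field_simps power2_eq_square)
    moreover have "(y \<bullet> z) / (x \<bullet> z) < s"
      using key xy \<open>x \<bullet> z < 0\<close> by (simp add: s_def field_simps)
    ultimately show ?thesis by (simp add: r_def)
  qed
  have "0 < r" using xy pos by (simp add: r_def less_max_iff_disj)
  have "cuts_heights x y z w (k *\<^sub>R x - y)" if "r \<le> k" "k \<le> s" for k
  proof -
    have "k > 0" using \<open>0 < r\<close> that by simp
    have "k * (x \<bullet> y) \<le> y \<bullet> y"
      using that(2) xy by (simp add: s_def pos_le_divide_eq)
    moreover have "k * (x \<bullet> x) \<ge> x \<bullet> y"
      using that(1) pos by (simp add: r_def pos_divide_le_eq)
    moreover have "k * (x \<bullet> z) \<le> y \<bullet> z"
      using that(1) \<open>x \<bullet> z < 0\<close> by (simp add: r_def neg_divide_le_eq)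
    moreover have "k * (x \<bullet> w) \<le> 0" using \<open>k > 0\<close> \<open>x \<bullet> w < 0\<close> by (simp add: mult_le_0_iff)
    ultimately have "(k *\<^sub>R x - y) \<bullet> y \<le> 0" "(k *\<^sub>R x - y) \<bullet> z \<le> 0"
      "(k *\<^sub>R x - y) \<bullet> w \<le> 0" "(k *\<^sub>R x - y) \<bullet> x \<ge> 0"
      using yw inner_commute[of y x] unfolding inner_diff_left inner_scaleR_left by linarith+
    moreover have "x \<bullet> z \<le> 0" "x \<bullet> w \<le> 0"
      using \<open>x \<bullet> z < 0\<close> \<open>x \<bullet> w < 0\<close> by simp_all
    ultimately show ?thesis unfolding cuts_heights_def by blast
  qed
  then show ?thesis
    using \<open>0 < r\<close> \<open>r < s\<close> unfolding two_ratios_def by (meson less_imp_le order_refl)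
qed

lemma two_ratios_exist:
  fixes x y z w :: "'a::real_inner"
  assumes "x + y + z + w = 0" "x \<bullet> y > 0" "z \<bullet> w > 0" "(x \<bullet> y)\<^sup>2 < (x \<bullet> x) * (y \<bullet> y)"
  shows "two_ratios x y z w"
proof -
  have sym: "y + x + z + w = 0" "x + y + w + z = 0" "y + x + w + z = 0" "y \<bullet> x > 0" "w \<bullet> z > 0"
    "(y \<bullet> x)\<^sup>2 < (y \<bullet> y) * (x \<bullet> x)"
    using assms by (simp_all add: inner_commute algebra_simps)
  consider "y \<bullet> w > 0" | "y \<bullet> z > 0" | "x \<bullet> w > 0" | "x \<bullet> z > 0"
    | "x \<bullet> z \<le> 0" "x \<bullet> w \<le> 0" "y \<bullet> z \<le> 0" "y \<bullet> w \<le> 0"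
    by linarith
  then show ?thesis
  proof cases
    case 1
    show ?thesis by (rule two_ratios_obtuse[OF assms(1-3) 1 assms(4)])
  next
    case 2
    show ?thesis by (rule two_ratios_swap_cd[OF two_ratios_obtuse[OF sym(2) assms(2) sym(5) 2 assms(4)]])
  next
    case 3
    show ?thesis by (rule two_ratios_swap[OF two_ratios_obtuse[OF sym(1,4) assms(3) 3 sym(6)]])
  next
    case 4
    show ?thesis by (rule two_ratios_swap[OF two_ratios_swap_cd[OF two_ratios_obtuse[OF sym(3-5) 4 sym(6)]]])
  next
    case 5
    \<comment> \<open>Here both disjunctions hold by their second alternatives; strict
      Cauchy-Schwarz makes the two remaining bounds on the ratio compatible.\<close>
    have pos: "x \<bullet> x > 0" "y \<bullet> y > 0" using assms(2) by auto
    let ?r = "(x \<bullet> y) / (x \<bullet> x)" and ?s = "(y \<bullet> y) / (x \<bullet> y)"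
    have "0 < ?r" using pos assms(2) by simp
    moreover have "?r < ?s"
      using assms(2,4) pos by (simp add: field_simps power2_eq_square)
    moreover have "cuts_heights x y z w (k *\<^sub>R x - y)" if "?r \<le> k" "k \<le> ?s" for k
    proof -
      have "k * (x \<bullet> y) \<le> y \<bullet> y" using that(2) assms(2) by (simp add: pos_le_divide_eq)
      moreover have "k * (x \<bullet> x) \<ge> x \<bullet> y" using that(1) pos by (simp add: pos_divide_le_eq)
      ultimately show ?thesis
        using 5 by (simp add: cuts_heights_def inner_diff_left inner_commute[of y x])
    qed
    ultimately show ?thesis unfolding two_ratios_def by (meson less_imp_le order_refl)
  qed
qed

section \<open>The interval of admissible parameters on an edge\<close>

definition cut_parameters :: "'a::real_inner \<Rightarrow> 'a \<Rightarrow> 'a \<Rightarrow> 'a \<Rightarrow> real set" where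
  "cut_parameters x y z w = {t. 0 \<le> t \<and> t \<le> 1 \<and> cuts_heights x y z w (t *\<^sub>R x - (1 - t) *\<^sub>R y)}"

lemma convex_cut_parameters: "convex (cut_parameters x y z w)"
proof -
  let ?m = "\<lambda>t. t *\<^sub>R x - (1 - t) *\<^sub>R y"
  have m: "?m t \<bullet> v = (x \<bullet> v + y \<bullet> v) * t - y \<bullet> v" for t v
    by (simp add: inner_diff_left algebra_simps)
  have le: "convex {t. ?m t \<bullet> v \<le> 0}" for v
    using convex_halfspace_le[of "x \<bullet> v + y \<bullet> v" "y \<bullet> v"] unfolding m by simp
  have ge: "convex {t. ?m t \<bullet> v \<ge> 0}" for v
    using convex_halfspace_ge[of "y \<bullet> v" "x \<bullet> v + y \<bullet> v"] unfolding m by simp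
  \<comment> \<open>A disjunction with an alternative independent of \<open>t\<close> is either no
    condition or just its other alternative, so only half-lines are intersected.\<close>
  have "cut_parameters x y z w = {0..1} \<inter> {t. ?m t \<bullet> y \<le> 0} \<inter> {t. ?m t \<bullet> x \<ge> 0} \<inter>
    (if y \<bullet> z \<le> 0 \<and> y \<bullet> w \<le> 0 then UNIV else {t. ?m t \<bullet> z \<le> 0} \<inter> {t. ?m t \<bullet> w \<le> 0}) \<inter>
    (if x \<bullet> z \<le> 0 \<and> x \<bullet> w \<le> 0 then UNIV else {t. ?m t \<bullet> z \<ge> 0} \<inter> {t. ?m t \<bullet> w \<ge> 0})"
    by (auto simp: cut_parameters_def cuts_heights_def)
  also have "convex \<dots>" using le ge by (auto intro!: convex_Int)
  finally show ?thesis .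
qed

text \<open>At \<open>t = 0\<close> the normal is \<open>- y\<close>, violating
  \<open>m \<bullet> x \<ge> 0\<close>; at \<open>t = 1\<close> it is \<open>x\<close>, violating
  \<open>m \<bullet> y \<le> 0\<close>.\<close>

lemma cut_parameters_interior:
  assumes "x \<bullet> y > 0" "t \<in> cut_parameters x y z w"
  shows "0 < t" "t < 1"
proof -
  have "t \<noteq> 0"
    using assms by (auto simp: cut_parameters_def cuts_heights_def inner_commute)
  moreover have "t \<noteq> 1"
    using assms by (auto simp: cut_parameters_def cuts_heights_def)
  ultimately show "0 < t" "t < 1" using assms(2) by (auto simp: cut_parameters_def)
qed

lemma ratio_cut_parameter:
  assumes "r > 0" "cuts_heights x y z w (r *\<^sub>R x - y)"
  shows "r / (1 + r) \<in> cut_parameters x y z w"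
proof -
  have "1 - r / (1 + r) = 1 / (1 + r)" using assms(1) by (simp add: field_simps)
  then have "(r / (1 + r)) *\<^sub>R x - (1 - r / (1 + r)) *\<^sub>R y = (1 / (1 + r)) *\<^sub>R (r *\<^sub>R x - y)"
    by (simp add: scaleR_diff_right)
  moreover have "cuts_heights x y z w ((1 / (1 + r)) *\<^sub>R (r *\<^sub>R x - y))"
    using assms by (subst cuts_heights_scale) simp_all
  ultimately show ?thesis using assms(1) by (simp add: cut_parameters_def)
qed

text \<open>The second piece has normal \<open>- m\<close>, which yields the reversed inequalities
  in \<open>cuts_heights\<close>.\<close>

lemma (in split_tetrahedron) induces_iff_cut_parameter:
  assumes "g c \<bullet> g d > 0"
  shows "induces_height_function_subdivision (affine hull (convex hull {c, d} \<union> {p})) (convex hull {a, b, c, d})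
    \<longleftrightarrow> t \<in> cut_parameters (g a) (g b) (g c) (g d)"
proof -
  interpret s: split_tetrahedron b a c d g "1 - t" by (rule swap_split)
  have [simp]: "s.p = p" "s.m = - m"
    by (simp_all add: p_def s.p_def m_def s.m_def)
  show ?thesis
    unfolding induces_iff_pieces height_function_piece_iff[OF assms]
    using s.height_function_piece_iff[OF assms] t
    by (auto simp: cut_parameters_def cuts_heights_def simp flip: m_def)
qed

lemma (in tetrahedron_gradients) not_induces_at_vertex:
  "\<not> induces_height_function_subdivision (affine hull (convex hull {c, d} \<union> {a})) (convex hull {a, b, c, d})"
proof -
  have "{c, d} \<union> {a} = {a, c, d}" by auto
  then show ?thesis
    using no_subdivision_through_facet
    unfolding affine_hull_convex_hull_Un induces_height_function_subdivision_def by simp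
qed

lemma (in tetrahedron_gradients) cutting_interval:
  assumes "g a \<bullet> g b > 0" "g c \<bullet> g d > 0"
  shows "\<exists>I. nontrivial_interval_in (rel_interior (convex hull {a, b})) I \<and>
    (\<forall>p\<in>convex hull {a, b}. induces_height_function_subdivision (affine hull (convex hull {c, d} \<union> {p}))
      (convex hull {a, b, c, d}) \<longleftrightarrow> p \<in> I)"
proof -
  interpret s: tetrahedron_gradients b a c d g by (rule swap_ab)
  define K where "K = cut_parameters (g a) (g b) (g c) (g d)"
  define \<gamma> where "\<gamma> t = (1 - t) *\<^sub>R a + t *\<^sub>R b" for t
  have "a \<noteq> b" using vertices_distinct by simp
  \<comment> \<open>The coordinate \<open>bary b\<close> recovers \<open>t\<close> from
    \<open>\<gamma> t\<close>, so the parametrisation is injective.\<close>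
  have "bary b (\<gamma> t) = (1 - t) * bary b a + t * bary b b" for t
    by (simp add: bary_def \<gamma>_def inner_diff_right inner_add_right algebra_simps)
  then have inj: "\<gamma> s = \<gamma> t \<longleftrightarrow> s = t" for s t
    unfolding bary_at by (metis mult_1_right mult_zero_right add_0)
  have K: "0 < t" "t < 1" if "t \<in> K" for t
    using that cut_parameters_interior[OF assms(1)] unfolding K_def by blast+
  have hull: "convex hull {a, b} = \<gamma> ` {0..1}"
    by (auto simp: in_segment \<gamma>_def simp flip: segment_convex_hull)
  have "\<gamma> t \<in> open_segment a b" if "t \<in> K" for t
    using K[OF that] \<open>a \<noteq> b\<close> unfolding in_segment \<gamma>_def by blast
  then have "\<gamma> ` K \<subseteq> rel_interior (convex hull {a, b})"
    using \<open>a \<noteq> b\<close> by (auto simp: rel_interior_closed_segment simp flip: segment_convex_hull)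
  moreover have "connected (\<gamma> ` K)"
    using convex_connected[OF convex_cut_parameters] unfolding K_def \<gamma>_def
    by (intro connected_continuous_image continuous_intros)
  moreover have "\<exists>x\<in>\<gamma> ` K. \<exists>y\<in>\<gamma> ` K. x \<noteq> y"
  proof -
    have "g b \<noteq> k *\<^sub>R g a" for k
      using vertices_distinct by (intro gradients_not_parallel[where u = c]) auto
    then have "(g a \<bullet> g b)\<^sup>2 < (g a \<bullet> g a) * (g b \<bullet> g b)"
      using gradient_nonzero by (intro inner_power2_less) auto
    then obtain r s where "0 < r" "r < s" "r / (1 + r) \<in> K" "s / (1 + s) \<in> K"
      using two_ratios_exist[OF gradient_sum4 assms] ratio_cut_parameter
      unfolding two_ratios_def K_def by (meson less_trans)
    moreover from this have "r / (1 + r) \<noteq> s / (1 + s)" by (simp add: field_simps)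
    ultimately show ?thesis using inj by blast
  qed
  ultimately have "nontrivial_interval_in (rel_interior (convex hull {a, b})) (\<gamma> ` K)"
    by (simp add: nontrivial_interval_in_def)
  moreover have "induces_height_function_subdivision (affine hull (convex hull {c, d} \<union> {\<gamma> t}))
      (convex hull {a, b, c, d}) \<longleftrightarrow> \<gamma> t \<in> \<gamma> ` K" if t: "0 \<le> t" "t \<le> 1" for t
  proof -
    have mem: "\<gamma> t \<in> \<gamma> ` K \<longleftrightarrow> t \<in> K" by (simp add: image_iff inj)
    \<comment> \<open>At the endpoints both sides are false: the plane contains a facet, and
      \<open>K\<close> lies strictly between 0 and 1.\<close>
    consider "t = 0" | "t = 1" | "0 < t" "t < 1" using t by linarith
    then show ?thesis
    proof cases
      case 1
      then have "\<gamma> t = a" "t \<notin> K" using K by (auto simp: \<gamma>_def)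
      then show ?thesis using not_induces_at_vertex mem by metis
    next
      case 2
      then have "\<gamma> t = b" "t \<notin> K" using K by (auto simp: \<gamma>_def)
      moreover have "{b, a, c, d} = {a, b, c, d}" by (rule insert_commute)
      ultimately show ?thesis using s.not_induces_at_vertex mem by metis
    next
      case 3
      then interpret q: split_tetrahedron a b c d g t by unfold_locales
      show ?thesis
        using q.induces_iff_cut_parameter[OF assms(2)] mem unfolding q.p_def K_def \<gamma>_def by simp
    qed
  qed
  then have "\<forall>p\<in>convex hull {a, b}. induces_height_function_subdivision (affine hull (convex hull {c, d} \<union> {p}))
      (convex hull {a, b, c, d}) \<longleftrightarrow> p \<in> \<gamma> ` K"
    unfolding hull by auto
  ultimately show ?thesis by blast
qed

section \<open>Edges of a simplex and the conclusion\<close>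

lemma edge_of_simplex:
  assumes "\<not> affine_dependent C" "e edge_of (convex hull C)"
  obtains a b where "a \<in> C" "b \<in> C" "a \<noteq> b" "e = convex hull {a, b}"
proof -
  obtain D where D: "D \<subseteq> C" "e = convex hull D"
    using assms face_of_convex_hull_affine_independent unfolding edge_of_def by blast
  then have "\<not> affine_dependent D" using assms(1) affine_dependent_subset by blast
  moreover have "aff_dim D = 1" using assms(2) D(2) by (simp add: edge_of_def aff_dim_convex_hull)
  ultimately have "card D = 2" using aff_dim_affine_independent[of D] by simp
  then obtain a b where "D = {a, b}" "a \<noteq> b" by (auto simp: card_2_iff)
  then show ?thesis using that D by blast
qed

theorem theorem6p1:
  fixes T e e' :: "(real^3) set"
  assumes "tetrahedron T"
    and "e edge_of T" and "e' edge_of T" and "e \<inter> e' = {}"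
    and "dihedral_angle T e > pi / 2" and "dihedral_angle T e' > pi / 2"
  shows "\<exists>I I'. nontrivial_interval_in (rel_interior e) I \<and>
                nontrivial_interval_in (rel_interior e') I' \<and>
                (\<forall>p\<in>e. induces_height_function_subdivision (affine hull (e' \<union> {p})) T \<longleftrightarrow> p \<in> I) \<and>
                (\<forall>p\<in>e'. induces_height_function_subdivision (affine hull (e \<union> {p})) T \<longleftrightarrow> p \<in> I')"
proof -
  obtain C where C: "\<not> affine_dependent C" "card C = 4" "T = convex hull C"
    using assms(1) by (auto simp: simplex_def)
  obtain a b where ab: "a \<in> C" "b \<in> C" "a \<noteq> b" "e = convex hull {a, b}"
    using edge_of_simplex[OF C(1)] assms(2) C(3) by blast
  obtain c d where cd: "c \<in> C" "d \<in> C" "c \<noteq> d" "e' = convex hull {c, d}"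
    using edge_of_simplex[OF C(1)] assms(3) C(3) by blast
  \<comment> \<open>Disjoint edges have four distinct endpoints, which exhaust the vertices.\<close>
  have "a \<in> e" "b \<in> e" "c \<in> e'" "d \<in> e'" by (simp_all add: ab cd hull_inc)
  then have "a \<noteq> c" "a \<noteq> d" "b \<noteq> c" "b \<noteq> d" using assms(4) by blast+
  then have "card {a, b, c, d} = 4" using ab(3) cd(3) by simp
  moreover have "finite C" using C(2) card.infinite by fastforce
  ultimately have "{a, b, c, d} = C"
    using ab cd C(2) by (intro card_subset_eq) auto
  then have T: "T = convex hull {a, b, c, d}" using C(3) by simp
  have "\<exists>g. simplex_gradients C g" by (rule simplex_gradients_exist) (use C in simp_all)
  then obtain g where "simplex_gradients {a, b, c, d} g" using \<open>_ = C\<close> by auto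
  then interpret tetrahedron_gradients a b c d g by (simp add: tetrahedron_gradients_def)
  interpret s: tetrahedron_gradients c d a b g by (rule swap_edges)
  have T': "T = convex hull {c, d, a, b}" by (simp add: T insert_commute)
  \<comment> \<open>Each obtuse angle concerns the gradients at the ends of the opposite edge, so
    both angles enter each of the two claims.\<close>
  have "g c \<bullet> g d > 0" using obtuse_imp_gradients assms(5) ab(4) T by simp
  moreover have "g a \<bullet> g b > 0" using s.obtuse_imp_gradients assms(6) cd(4) T' by simp
  ultimately show ?thesis
    using cutting_interval s.cutting_interval unfolding T[symmetric] T'[symmetric] ab(4)[symmetric] cd(4)[symmetric]
    by blast
qed

end
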